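(* Let $\mathbf A\in\mathbb R^{m\times n}$ be nonzero and $\mathbf b\in\mathbb R^m$, and let $\alpha_{\rm r}$ satisfy $0<\alpha_{\rm r}<2/\lambda_{\max}^{\rm r}$. If the linear system $\mathbf A\mathbf x=\mathbf b$ is consistent, then for arbitrary $\mathbf x^0\in\mathbb R^n$ and every $k\ge 0$, the $k$th iterate $\mathbf x^k$ of the block row sampling iterative (BRSI) algorithm with stepsize $\alpha_{\rm r}$ satisfies $$\mathbb E\left[\|\mathbf x^k-\mathbf x_\star^0\|^2\right]\leq \eta_{\rm r}^k\,\|\mathbf x^0-\mathbf x_\star^0\|^2,$$ where $$\eta_{\rm r}=1-\alpha_{\rm r}(2-\alpha_{\rm r}\lambda_{\max}^{\rm r})\sigma_{\min}^2(\mathbf A).$$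
   Context: Notation: $\|\cdot\|$ is the Euclidean norm, $\mathbf A^\dagger$ is the Moore--Penrose pseudoinverse, $\sigma_{\min}(\mathbf A)$ is the smallest nonzero singular value of $\mathbf A$, and $\lambda_{\max}(\cdot)$ is the largest eigenvalue of a symmetric matrix. Define $\mathbf x_\star^0:=\mathbf A^\dagger\mathbf b+(\mathbf I-\mathbf A^\dagger\mathbf A)\mathbf x^0$. BRSI algorithm: let $\mathcal D_{\rm r}$ be a (discrete or continuous) distribution of random real matrices $\mathbf S$ with $m$ rows (the number of columns may itself be random) such that $\mathbb E[\mathbf S\mathbf S^\top]=\mathbf I$. Given $\mathbf x^0\in\mathbb R^n$ (deterministic) and a stepsize $\alpha_{\rm r}>0$, for $k\ge1$, $$\mathbf x^k=\mathbf x^{k-1}-\alpha_{\rm r}\mathbf A^\top\mathbf S\mathbf S^\top(\mathbf A\mathbf x^{k-1}-\mathbf b),$$ where at each iteration a fresh $\mathbf S\sim\mathcal D_{\rm r}$ is drawn, independently of all previous iterations. Define $\lambda_{\max}^{\rm r}=\max_{\mathbf S\sim\mathcal D_{\rm r}}\lambda_{\max}(\mathbf A^\top\mathbf S\mathbf S^\top\mathbf A)$, the maximum being over the possible realizations of $\mathbf S$; this maximum is assumed to exist (in particular to be finite). *)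

theory Defs
  imports "HOL-Probability.Probability"
begin

definition eigval :: "real^'n^'n \<Rightarrow> real \<Rightarrow> bool" where
  "eigval M \<mu> \<longleftrightarrow> (\<exists>v. v \<noteq> 0 \<and> M *v v = \<mu> *\<^sub>R v)"

definition lambda_max :: "real^'n^'n \<Rightarrow> real" where
  "lambda_max M = Max {\<mu>. eigval M \<mu>}"

text \<open>If there are more columns than rows, \<open>transpose A ** A\<close> contributes surplus zeros compared
  with the list of \<open>min m n\<close> singular values; the nonzero ones are the same.\<close>

definition singular_values :: "real^'n^'m \<Rightarrow> real set" where
  "singular_values A = sqrt ` {\<mu>. eigval (transpose A ** A) \<mu>}"

definition sigma_min :: "real^'n^'m \<Rightarrow> real" where
  "sigma_min A = Min (singular_values A - {0})"

text \<open>The Moore--Penrose pseudoinverse, as the unique solution of the four Penrose equations.\<close>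

definition pinv :: "real^'n^'m \<Rightarrow> real^'m^'n" where
  "pinv A = (THE X. A ** X ** A = A \<and> X ** A ** X = X \<and>
     transpose (A ** X) = A ** X \<and> transpose (X ** A) = X ** A)"

definition x_star0 :: "real^'n^'m \<Rightarrow> real^'m \<Rightarrow> real^'n \<Rightarrow> real^'n" where
  "x_star0 A b x0 = pinv A *v b + (mat 1 - pinv A ** A) *v x0"

text \<open>The number of columns of the sampling matrix may be random, so it cannot be a type. A matrix
  with \<open>'m\<close>-indexed rows and an arbitrary number of columns is the list of its columns: the
  \<open>(i, k)\<close> entry of \<open>S\<close> is \<open>S ! k $ i\<close>.\<close>

type_synonym 'm cols = "(real^'m) list"

definition SSt :: "'m::finite cols \<Rightarrow> real^'m^'m" where
  "SSt S = (\<chi> i j. \<Sum>k<length S. S ! k $ i * S ! k $ j)"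

text \<open>The Borel structure on the disjoint union over \<open>q\<close> of the spaces of matrices with \<open>q\<close>
  columns, generated by the measurable rectangles with a fixed number of columns.\<close>

definition cols_space :: "'m::finite cols measure" where
  "cols_space = sigma UNIV
     {{S. length S = q \<and> (\<forall>k<q. S ! k \<in> B k)} | q B. \<forall>k. B k \<in> sets borel}"

text \<open>The parameter \<open>R\<close> is the set of possible realizations of the sampling matrix.\<close>

definition lambda_max_r :: "real^'n^'m \<Rightarrow> 'm cols set \<Rightarrow> real" where
  "lambda_max_r A R =
     (GREATEST l. l \<in> (\<lambda>S. lambda_max (transpose A ** SSt S ** A)) ` R)"

definition eta_r :: "real^'n^'m \<Rightarrow> 'm cols set \<Rightarrow> real \<Rightarrow> real" where
  "eta_r A R \<alpha> = 1 - \<alpha> * (2 - \<alpha> * lambda_max_r A R) * (sigma_min A)\<^sup>2"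

text \<open>The matrix drawn in iteration \<open>k + 1\<close> is \<open>S k\<close>.\<close>

primrec brsi ::
  "real^'n^'m \<Rightarrow> real^'m \<Rightarrow> real \<Rightarrow> real^'n \<Rightarrow> (nat \<Rightarrow> 'm cols) \<Rightarrow> nat \<Rightarrow> real^'n" where
  "brsi A b \<alpha> x0 S 0 = x0"
| "brsi A b \<alpha> x0 S (Suc k) =
     brsi A b \<alpha> x0 S k
       - \<alpha> *\<^sub>R ((transpose A ** SSt (S k)) *v (A *v brsi A b \<alpha> x0 S k - b))"

text \<open>\<open>R\<close> may be any set carrying the distribution \<open>D\<close>, for instance its set of atoms, its
  topological support, or the range of a random matrix with law \<open>D\<close>.\<close>

definition sampling_distribution :: "'m::finite cols measure \<Rightarrow> 'm cols set \<Rightarrow> bool" where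
  "sampling_distribution D R \<longleftrightarrow>
     prob_space D \<and> sets D = sets cols_space \<and> (AE S in D. S \<in> R) \<and>
     has_bochner_integral D SSt (mat 1)"

end

theory Submission
  imports Defs
begin

text \<open>Every error \<open>e = x\<^sup>k - x\<^sub>\<star>\<^sup>0\<close> lies in the row space of \<open>A\<close>, where the
  smallest nonzero singular value \<open>\<sigma>\<close> satisfies \<open>\<sigma>\<^sup>2 \<parallel>e\<parallel>\<^sup>2 \<le> \<parallel>A e\<parallel>\<^sup>2\<close>.
  One iteration maps \<open>e\<close> to \<open>e - \<alpha> N e\<close> with \<open>N = A\<^sup>T S S\<^sup>T A\<close>. Since \<open>N\<close> is positive semidefinite with
  eigenvalues at most \<open>\<lambda>\<close>, we have \<open>\<parallel>N e\<parallel>\<^sup>2 \<le> \<lambda> (e \<bullet> N e)\<close>, so the squared norm drops by at least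
  \<open>\<alpha> (2 - \<alpha> \<lambda>) (e \<bullet> N e)\<close>. The fresh \<open>S\<close> is independent of \<open>e\<close> and \<open>S S\<^sup>T\<close> has mean \<open>I\<close>, so
  the expectation of \<open>e \<bullet> N e\<close> is that of \<open>\<parallel>A e\<parallel>\<^sup>2\<close>. In particular errors never grow, which makes
  every iterate bounded almost surely and settles integrability.\<close>

section \<open>Symmetric matrices\<close>

lemma inner_matrix_transpose:
  fixes A :: "real^'n^'m"
  shows "x \<bullet> (A *v y) = (transpose A *v x) \<bullet> y"
  by (simp add: dot_lmul_matrix)

text \<open>As a simp rule it would rewrite \<open>transpose A *v x\<close> to
  \<open>x v* A\<close>, destroying the form in which the adjoint identity above is used.\<close>

declare transpose_matrix_vector [simp del]

text \<open>Near \<open>t = 0\<close> the linear term dominates and changes sign with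
  \<open>t\<close>. This is the first-order condition at a minimum.\<close>

lemma quadratic_nonneg_imp_linear_zero:
  fixes p q :: real
  assumes "\<And>t. 0 \<le> 2 * t * p + t\<^sup>2 * q"
  shows "p = 0"
proof (rule ccontr)
  assume "p \<noteq> 0"
  have q: "0 \<le> q"
    using assms[of 1] assms[of "-1"] by simp
  \<comment> \<open>The denominator \<open>q + 1\<close> stays positive even for
    \<open>q = 0\<close>; the quadratic then collapses to
    \<open>- (t\<^sup>2 * (q + 2))\<close>.\<close>
  define t where "t = - p / (q + 1)"
  have p: "p = - t * (q + 1)"
    using q by (simp add: t_def field_simps)
  have "0 \<le> 2 * t * p + t\<^sup>2 * q"
    by (rule assms)
  also have "\<dots> = - (t\<^sup>2 * (q + 2))"
    unfolding p by (simp add: power2_eq_square algebra_simps)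
  finally have "t = 0"
    using q by (simp add: mult_le_0_iff)
  with p \<open>p \<noteq> 0\<close> show False by simp
qed

text \<open>The Rayleigh quotient attains its minimum on the compact unit sphere of
  \<open>V\<close>, and stationarity makes the minimiser an eigenvector. The invariant subspace is a
  parameter because the row space of a matrix is needed as well as the whole space.\<close>

lemma rayleigh_minimum:
  fixes M :: "real^'n^'n"
  assumes sym: "transpose M = M" and V: "subspace V" "V \<noteq> {0}"
    and inv: "\<And>x. x \<in> V \<Longrightarrow> M *v x \<in> V"
  obtains v \<mu> where "v \<in> V" "v \<noteq> 0" "M *v v = \<mu> *\<^sub>R v"
    "\<And>x. x \<in> V \<Longrightarrow> \<mu> * (norm x)\<^sup>2 \<le> x \<bullet> (M *v x)"
proof -
  have "compact (V \<inter> sphere 0 1)"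
    by (intro closed_Int_compact closed_subspace V compact_sphere)
  moreover obtain u where u: "u \<in> V" "u \<noteq> 0"
    using V subspace_0 by blast
  have "(1 / norm u) *\<^sub>R u \<in> V \<inter> sphere 0 1"
    using u V by (simp add: subspace_scale)
  then have "V \<inter> sphere 0 1 \<noteq> {}"
    by blast
  moreover have "continuous_on (V \<inter> sphere 0 1) (\<lambda>x. x \<bullet> (M *v x))"
    by (intro continuous_on_inner continuous_on_id matrix_vector_mult_linear_continuous_on)
  ultimately have "\<exists>v\<in>V \<inter> sphere 0 1. \<forall>x\<in>V \<inter> sphere 0 1. v \<bullet> (M *v v) \<le> x \<bullet> (M *v x)"
    by (rule continuous_attains_inf)
  then obtain v where v: "v \<in> V \<inter> sphere 0 1"
    and vmin: "\<And>x. x \<in> V \<inter> sphere 0 1 \<Longrightarrow> v \<bullet> (M *v v) \<le> x \<bullet> (M *v x)"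
    by blast
  define \<mu> where "\<mu> = v \<bullet> (M *v v)"
  have bound: "\<mu> * (norm x)\<^sup>2 \<le> x \<bullet> (M *v x)" if "x \<in> V" for x
  proof (cases "x = 0")
    case False
    have "(1 / norm x) *\<^sub>R x \<in> V \<inter> sphere 0 1"
      using that False V by (simp add: subspace_scale)
    from vmin[OF this] have "\<mu> \<le> (x \<bullet> (M *v x)) / (norm x)\<^sup>2"
      by (simp add: \<mu>_def matrix_vector_mult_scaleR power2_eq_square)
    then show ?thesis
      using False by (simp add: field_simps)
  qed simp
  \<comment> \<open>The minimiser is perturbed along its own eigenvalue residual, which stays in
    \<open>V\<close> by invariance. The first-order coefficient is then
    \<open>w \<bullet> w\<close>, so the residual vanishes.\<close>
  define w where "w = M *v v - \<mu> *\<^sub>R v"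
  have w: "w \<in> V"
    unfolding w_def using v V inv by (simp add: subspace_diff subspace_scale)
  have vw: "v \<bullet> (M *v w) = w \<bullet> (M *v v)"
    using inner_matrix_transpose[of v M w] sym by (simp add: inner_commute)
  have vv: "v \<bullet> v = 1"
    using v by (simp add: dot_square_norm)
  have "0 \<le> 2 * t * (w \<bullet> w) + t\<^sup>2 * (w \<bullet> (M *v w) - \<mu> * (w \<bullet> w))" for t
  proof -
    have "v + t *\<^sub>R w \<in> V"
      using v w V by (simp add: subspace_add subspace_scale)
    from bound[OF this]
    have "\<mu> * ((v + t *\<^sub>R w) \<bullet> (v + t *\<^sub>R w)) \<le> (v + t *\<^sub>R w) \<bullet> (M *v (v + t *\<^sub>R w))"
      by (simp add: dot_square_norm)
    also have "\<dots> = \<mu> + 2 * t * (w \<bullet> (M *v v)) + t\<^sup>2 * (w \<bullet> (M *v w))"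
      by (simp add: matrix_vector_right_distrib matrix_vector_mult_scaleR inner_add_left
          inner_add_right vw \<mu>_def power2_eq_square distrib_left)
    finally have "\<mu> * (1 + 2 * t * (w \<bullet> v) + t\<^sup>2 * (w \<bullet> w))
        \<le> \<mu> + 2 * t * (w \<bullet> (M *v v)) + t\<^sup>2 * (w \<bullet> (M *v w))"
      by (simp add: inner_add_left inner_add_right vv power2_eq_square inner_commute distrib_left)
    moreover have "w \<bullet> w = w \<bullet> (M *v v) - \<mu> * (w \<bullet> v)"
      by (subst (2) w_def) (simp add: inner_diff_right)
    then have "2 * t * (w \<bullet> w) = 2 * t * (w \<bullet> (M *v v)) - \<mu> * (2 * t * (w \<bullet> v))"
      by (simp add: right_diff_distrib)
    ultimately show ?thesis
      by (simp add: distrib_left right_diff_distrib mult.left_commute)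
  qed
  then have "w \<bullet> w = 0"
    by (rule quadratic_nonneg_imp_linear_zero)
  then have "M *v v = \<mu> *\<^sub>R v"
    by (simp add: w_def)
  then show thesis
    using that[of v \<mu>] v bound vv by (cases "v = 0") simp_all
qed

text \<open>Eigenvectors of distinct eigenvalues are orthogonal, and a pairwise orthogonal set is
  finite. This gives \<open>Max\<close> and \<open>Min\<close> their intended meaning in
  \<open>lambda_max\<close> and \<open>sigma_min\<close>.\<close>

lemma finite_eigval_symmetric:
  fixes M :: "real^'n^'n"
  assumes sym: "transpose M = M"
  shows "finite {\<mu>. eigval M \<mu>}"
proof -
  define f where "f \<mu> = (SOME v. v \<noteq> 0 \<and> M *v v = \<mu> *\<^sub>R v)" for \<mu>
  have f: "f \<mu> \<noteq> 0 \<and> M *v f \<mu> = \<mu> *\<^sub>R f \<mu>" if "eigval M \<mu>" for \<mu>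
    unfolding f_def using that unfolding eigval_def by (rule someI_ex)
  have orth: "f \<mu> \<bullet> f \<nu> = 0" if "eigval M \<mu>" "eigval M \<nu>" "\<mu> \<noteq> \<nu>" for \<mu> \<nu>
  proof -
    have "\<mu> * (f \<mu> \<bullet> f \<nu>) = \<nu> * (f \<mu> \<bullet> f \<nu>)"
      using inner_matrix_transpose[of "f \<mu>" M "f \<nu>"] f[OF that(1)] f[OF that(2)] sym by auto
    with that(3) show ?thesis by (metis mult_right_cancel)
  qed
  have inj: "inj_on f {\<mu>. eigval M \<mu>}"
    using orth f by (force simp: inj_on_def)
  have "pairwise orthogonal (f ` {\<mu>. eigval M \<mu>})"
    unfolding pairwise_def orthogonal_def using orth by auto
  then have "finite (f ` {\<mu>. eigval M \<mu>})"
    by (rule pairwise_orthogonal_imp_finite)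
  then show ?thesis
    using inj finite_imageD by blast
qed

text \<open>The Rayleigh minimum of \<open>- M\<close> is the negative of an eigenvalue of
  \<open>M\<close> that bounds the form from above.\<close>

lemma quadratic_form_le_lambda_max:
  fixes M :: "real^'n^'n"
  assumes sym: "transpose M = M"
  shows "x \<bullet> (M *v x) \<le> lambda_max M * (norm x)\<^sup>2"
proof -
  have neg: "(- M) *v y = - (M *v y)" for y
    using matrix_vector_mult_diff_rdistrib[of 0 M y] by simp
  have "transpose (- M) = - M"
    using sym by (simp add: transpose_def vec_eq_iff)
  moreover have "(UNIV :: (real^'n) set) \<noteq> {0}"
    by (metis UNIV_I axis_eq_0_iff singletonD zero_neq_one)
  ultimately obtain v \<mu> where v: "v \<noteq> 0" "(- M) *v v = \<mu> *\<^sub>R v"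
    and bound: "\<And>y. \<mu> * (norm y)\<^sup>2 \<le> y \<bullet> ((- M) *v y)"
    by (rule rayleigh_minimum[OF _ subspace_UNIV]) auto
  have "M *v v = - ((- M) *v v)"
    by (simp add: neg)
  also have "\<dots> = (- \<mu>) *\<^sub>R v"
    using v(2) by simp
  finally have "M *v v = (- \<mu>) *\<^sub>R v" .
  then have "eigval M (- \<mu>)"
    using v(1) unfolding eigval_def by blast
  then have "- \<mu> \<le> lambda_max M"
    unfolding lambda_max_def by (intro Max_ge finite_eigval_symmetric sym) simp
  then have "- \<mu> * (norm x)\<^sup>2 \<le> lambda_max M * (norm x)\<^sup>2"
    by (rule mult_right_mono) simp
  with bound[of x] show ?thesis
    by (simp add: neg)
qed

text \<open>This is the operator inequality \<open>N ** N \<le> c N\<close>, obtained by testing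
  nonnegativity at a single shifted point instead of diagonalising \<open>N\<close>.\<close>

lemma norm_symmetric_nonneg_le:
  fixes N :: "real^'n^'n"
  assumes sym: "transpose N = N" and nonneg: "\<And>y. 0 \<le> y \<bullet> (N *v y)"
    and bound: "\<And>y. y \<bullet> (N *v y) \<le> c * (norm y)\<^sup>2" and "0 < c"
  shows "(norm (N *v x))\<^sup>2 \<le> c * (x \<bullet> (N *v x))"
proof -
  define y where "y = N *v x"
  have xy: "x \<bullet> (N *v y) = y \<bullet> y"
    using inner_matrix_transpose[of x N y] sym by (simp add: y_def)
  \<comment> \<open>\<open>1 / c\<close> minimises the upper bound \<open>x \<bullet> y - 2 t \<parallel>y\<parallel>\<^sup>2 + t\<^sup>2 c \<parallel>y\<parallel>\<^sup>2\<close> on the form at \<open>x - t y\<close>.\<close>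
  have "0 \<le> (x - (1/c) *\<^sub>R y) \<bullet> (N *v (x - (1/c) *\<^sub>R y))"
    by (rule nonneg)
  also have "\<dots> = x \<bullet> y - 2 / c * (y \<bullet> y) + (y \<bullet> (N *v y)) / c\<^sup>2"
    using xy by (simp add: matrix_vector_mult_diff_distrib matrix_vector_mult_scaleR inner_diff_left
        inner_diff_right power2_eq_square diff_divide_distrib flip: y_def)
  also have "\<dots> \<le> x \<bullet> y - 2 / c * (y \<bullet> y) + (c * (norm y)\<^sup>2) / c\<^sup>2"
    by (intro add_left_mono divide_right_mono bound) simp
  also have "\<dots> = x \<bullet> y - (norm y)\<^sup>2 / c"
    using \<open>0 < c\<close> by (simp add: dot_square_norm power2_eq_square field_simps)
  finally show ?thesis
    using \<open>0 < c\<close> by (simp add: y_def field_simps)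
qed

section \<open>The smallest nonzero singular value\<close>

lemma matrix_vector_zero_iff:
  fixes A :: "real^'n^'m"
  shows "(\<forall>x. A *v x = 0) \<longleftrightarrow> A = 0"
  by (metis matrix_eq matrix_vector_mult_0)

lemma subspace_range_matrix:
  fixes A :: "real^'n^'m"
  shows "subspace (range ((*v) A))"
  by (intro linear_subspace_image subspace_UNIV matrix_vector_mul_linear)

lemma range_transpose_nontrivial:
  fixes A :: "real^'n^'m"
  assumes "A \<noteq> 0"
  shows "range ((*v) (transpose A)) \<noteq> {0}"
proof
  assume "range ((*v) (transpose A)) = {0}"
  then have "transpose A = 0"
    by (metis matrix_vector_zero_iff rangeI singletonD)
  then have "transpose (transpose A) = 0"
    by (simp add: transpose_def vec_eq_iff)
  with assms show False by simp
qed

text \<open>The row space is invariant under \<open>transpose A ** A\<close> and meets the kernel of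
  \<open>A\<close> only in zero. The Rayleigh minimum there is thus a positive eigenvalue, whose
  root is one of the nonzero singular values.\<close>

lemma sigma_min_bound:
  fixes A :: "real^'n^'m"
  assumes "A \<noteq> 0" and x: "x \<in> range ((*v) (transpose A))"
  shows "(sigma_min A)\<^sup>2 * (norm x)\<^sup>2 \<le> (norm (A *v x))\<^sup>2"
proof -
  let ?M = "transpose A ** A"
  have sym: "transpose ?M = ?M"
    by (simp add: matrix_transpose_mul)
  have form: "y \<bullet> (?M *v y) = (norm (A *v y))\<^sup>2" for y
    by (simp add: inner_matrix_transpose flip: matrix_vector_mul_assoc dot_square_norm)
  obtain v \<mu> where v: "v \<in> range ((*v) (transpose A))" "v \<noteq> 0" "?M *v v = \<mu> *\<^sub>R v"
    and bound: "\<And>y. y \<in> range ((*v) (transpose A)) \<Longrightarrow> \<mu> * (norm y)\<^sup>2 \<le> y \<bullet> (?M *v y)"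
    using rayleigh_minimum[OF sym subspace_range_matrix range_transpose_nontrivial[OF assms(1)]]
    by (auto simp flip: matrix_vector_mul_assoc)
  have Av: "\<mu> * (norm v)\<^sup>2 = (norm (A *v v))\<^sup>2"
    using form[of v] v(3) by (simp add: dot_square_norm)
  have "A *v v \<noteq> 0"
  proof
    assume "A *v v = 0"
    moreover obtain u where "v = transpose A *v u" using v(1) by blast
    ultimately have "v \<bullet> v = 0"
      using inner_matrix_transpose[of u A v] by (simp add: inner_commute)
    with v(2) show False by simp
  qed
  then have "0 < \<mu> * (norm v)\<^sup>2"
    by (simp add: Av)
  then have \<mu>: "0 < \<mu>"
    by (simp add: zero_less_mult_iff)
  have fin: "finite (singular_values A - {0})"
    unfolding singular_values_def by (intro finite_Diff finite_imageI finite_eigval_symmetric sym)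
  have mem: "sqrt \<mu> \<in> singular_values A - {0}"
    unfolding singular_values_def eigval_def using v \<mu> by auto
  have le: "sigma_min A \<le> sqrt \<mu>"
    unfolding sigma_min_def by (rule Min_le[OF fin mem])
  \<comment> \<open>Since \<open>sqrt\<close> is odd on the reals, squaring \<open>le\<close>
    requires the eigenvalue behind \<open>sigma_min A\<close> to be nonnegative.\<close>
  have "sigma_min A \<in> singular_values A - {0}"
    unfolding sigma_min_def using fin mem by (intro Min_in) auto
  then obtain \<nu> where \<nu>: "sigma_min A = sqrt \<nu>" "eigval ?M \<nu>"
    unfolding singular_values_def by auto
  then obtain u where u: "u \<noteq> 0" "?M *v u = \<nu> *\<^sub>R u"
    unfolding eigval_def by blast
  have "\<nu> * (norm u)\<^sup>2 = (norm (A *v u))\<^sup>2"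
    using form[of u] u(2) by (simp add: dot_square_norm)
  moreover have "0 < (norm u)\<^sup>2"
    using u(1) by simp
  ultimately have "0 \<le> \<nu>"
    by (metis zero_le_mult_iff zero_le_power2 not_less)
  then have "(sigma_min A)\<^sup>2 \<le> \<mu>"
    using le \<nu>(1) \<mu> by simp
  then have "(sigma_min A)\<^sup>2 * (norm x)\<^sup>2 \<le> \<mu> * (norm x)\<^sup>2"
    by (rule mult_right_mono) simp
  with bound[OF x] form[of x] show ?thesis by simp
qed

section \<open>The Moore--Penrose pseudoinverse\<close>

text \<open>Projecting \<open>w\<close> orthogonally onto the column space of \<open>A\<close>
  solves the normal equations for \<open>w\<close>.\<close>

lemma least_squares_inverse:
  fixes A :: "real^'n^'m"
  obtains Y :: "real^'m^'n" where "transpose A ** A ** Y = transpose A"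
proof -
  have "\<exists>v. transpose A *v (A *v v) = transpose A *v w" for w
  proof -
    have "span (range ((*v) A)) = range ((*v) A)"
      using subspace_range_matrix by (simp add: span_eq_iff)
    then obtain y z where yz: "y \<in> range ((*v) A)" "\<And>u. u \<in> range ((*v) A) \<Longrightarrow> orthogonal z u"
        "w = y + z"
      using orthogonal_subspace_decomp_exists[of "range ((*v) A)" w] by metis
    have "(transpose A *v z) \<bullet> (transpose A *v z) = 0"
      using yz(2) unfolding orthogonal_def by (simp flip: inner_matrix_transpose)
    then have "transpose A *v z = 0" by simp
    then have "transpose A *v w = transpose A *v y"
      by (simp add: yz(3) matrix_vector_right_distrib)
    with yz(1) show ?thesis by (metis imageE)
  qed
  then obtain g where g: "\<And>w. transpose A *v (A *v g w) = transpose A *v w"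
    by metis
  \<comment> \<open>The choice \<open>g\<close> need not be linear: only its values at the basis
    vectors enter, as the columns of \<open>Y\<close>.\<close>
  define Y :: "real^'m^'n" where "Y = (\<chi> i j. g (axis j 1) $ i)"
  have col: "Y *v axis j 1 = g (axis j 1)" for j
    by (simp add: matrix_vector_mult_basis column_def Y_def vec_eq_iff)
  have "(transpose A ** A ** Y) *v axis j 1 = transpose A *v axis j 1" for j
    by (simp add: col g flip: matrix_vector_mul_assoc)
  then have "transpose A ** A ** Y = transpose A"
    by (simp add: matrix_vector_mult_basis column_def vec_eq_iff)
  then show thesis by (rule that)
qed

text \<open>The hypothesis gives \<open>transpose (A ** Y) ** (A ** Y) = transpose (A ** Y)\<close>,
  whose left side is symmetric. Transposing the hypothesis then yields the other equation.\<close>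

lemma least_squares_inverse_penrose:
  fixes A :: "real^'n^'m"
  assumes "transpose A ** A ** Y = transpose A"
  shows "A ** Y ** A = A" and "transpose (A ** Y) = A ** Y"
proof -
  have *: "transpose (A ** Y) ** (A ** Y) = transpose (A ** Y)"
    using assms by (simp add: matrix_transpose_mul flip: matrix_mul_assoc)
  then show sym: "transpose (A ** Y) = A ** Y"
    by (metis matrix_transpose_mul[of "transpose (A ** Y)" "A ** Y"] transpose_transpose)
  have "transpose (transpose A ** (A ** Y)) = A"
    using assms by (simp add: matrix_mul_assoc)
  then show "A ** Y ** A = A"
    unfolding matrix_transpose_mul[of "transpose A" "A ** Y"] sym by simp
qed

text \<open>The pseudoinverse is \<open>Z A Y\<close> for a least squares inverse \<open>Y\<close> of \<open>A\<close> and the transpose \<open>Z\<close> of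
  a least squares inverse of \<open>A\<^sup>T\<close>.\<close>

lemma pinv_penrose:
  fixes A :: "real^'n^'m"
  shows "A ** pinv A ** A = A \<and> pinv A ** A ** pinv A = pinv A \<and>
    transpose (A ** pinv A) = A ** pinv A \<and> transpose (pinv A ** A) = pinv A ** A"
proof -
  let ?P = "\<lambda>X. A ** X ** A = A \<and> X ** A ** X = X \<and>
     transpose (A ** X) = A ** X \<and> transpose (X ** A) = X ** A"
  obtain Y where Y: "A ** Y ** A = A" "transpose (A ** Y) = A ** Y"
    by (rule least_squares_inverse) (use least_squares_inverse_penrose in blast)
  obtain W where W: "transpose A ** W ** transpose A = transpose A"
      "transpose (transpose A ** W) = transpose A ** W"
    by (rule least_squares_inverse) (use least_squares_inverse_penrose in blast)
  define Z where "Z = transpose W"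
  have Z: "A ** Z ** A = A" "transpose (Z ** A) = Z ** A"
  proof -
    have "transpose (transpose A ** W ** transpose A) = A"
      by (simp add: W)
    then show "A ** Z ** A = A"
      by (simp add: Z_def matrix_transpose_mul matrix_mul_assoc)
    show "transpose (Z ** A) = Z ** A"
      using W(2) by (simp add: Z_def matrix_transpose_mul)
  qed
  have AX: "A ** (Z ** A ** Y) = A ** Y"
    by (simp add: matrix_mul_assoc Z)
  have "(Z ** A ** Y) ** A = Z ** (A ** Y ** A)"
    by (simp add: matrix_mul_assoc)
  then have XA: "(Z ** A ** Y) ** A = Z ** A"
    unfolding Y .
  have "Z ** A ** Y ** A ** (Z ** A ** Y) = Z ** (A ** Y ** A) ** Z ** A ** Y"
    by (simp add: matrix_mul_assoc)
  also have "\<dots> = Z ** (A ** Z ** A) ** Y"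
    unfolding Y by (simp add: matrix_mul_assoc)
  finally have "Z ** A ** Y ** A ** (Z ** A ** Y) = Z ** A ** Y"
    unfolding Z .
  then have "?P (Z ** A ** Y)"
    unfolding AX XA using Y Z by simp
  \<comment> \<open>Two solutions share both projections \<open>A ** X\<close> and
    \<open>X ** A\<close>, and these determine \<open>X = X ** A ** X\<close>.\<close>
  moreover have "X = X'" if X: "?P X" and X': "?P X'" for X X'
  proof -
    have "A ** X = A ** X' ** A ** X"
      using X' by simp
    also have "\<dots> = A ** X' ** (A ** X)"
      by (simp add: matrix_mul_assoc)
    also have "\<dots> = transpose (A ** X ** (A ** X'))"
      using X X' by (simp add: matrix_transpose_mul)
    also have "\<dots> = transpose (A ** X ** A ** X')"
      by (simp add: matrix_mul_assoc)
    also have "\<dots> = A ** X'"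
      using X X' by simp
    finally have 1: "A ** X = A ** X'" .
    have "X ** A = X ** (A ** X' ** A)"
      using X' by simp
    also have "\<dots> = X ** A ** (X' ** A)"
      by (simp add: matrix_mul_assoc)
    also have "\<dots> = transpose (X' ** A ** (X ** A))"
      using X X' by (simp add: matrix_transpose_mul)
    also have "\<dots> = transpose (X' ** (A ** X ** A))"
      by (simp add: matrix_mul_assoc)
    also have "\<dots> = X' ** A"
      using X X' by simp
    finally have 2: "X ** A = X' ** A" .
    have "X = X' ** A ** X"
      using X 2 by simp
    also have "\<dots> = X' ** (A ** X')"
      by (simp add: 1 flip: matrix_mul_assoc)
    also have "\<dots> = X'"
      using X' by (simp add: matrix_mul_assoc)
    finally show ?thesis .
  qed
  ultimately have "\<exists>!X. ?P X" by blast
  then show ?thesis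
    unfolding pinv_def by (rule theI')
qed

text \<open>For \<open>b = A *v y\<close>, the point is \<open>x0\<close> minus the projection of
  \<open>x0 - y\<close> by \<open>pinv A ** A\<close>. Symmetry of that projection puts its range
  inside the row space.\<close>

lemma x_star0_solves:
  fixes A :: "real^'n^'m"
  assumes "\<exists>x. A *v x = b"
  shows "A *v x_star0 A b x0 = b"
    and "x0 - x_star0 A b x0 \<in> range ((*v) (transpose A))"
proof -
  obtain y where y: "b = A *v y" using assms by blast
  note P = pinv_penrose[of A]
  have x: "x_star0 A b x0 = x0 - (pinv A ** A) *v (x0 - y)"
    by (simp add: x_star0_def y matrix_vector_mult_diff_rdistrib matrix_vector_mult_diff_distrib
        matrix_vector_mul_assoc)
  show "A *v x_star0 A b x0 = b"
    unfolding x using P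
    by (simp add: matrix_vector_mult_diff_distrib matrix_vector_mul_assoc matrix_mul_assoc y)
  have "x0 - x_star0 A b x0 = transpose (pinv A ** A) *v (x0 - y)"
    unfolding x using P by simp
  then show "x0 - x_star0 A b x0 \<in> range ((*v) (transpose A))"
    by (simp add: matrix_transpose_mul flip: matrix_vector_mul_assoc)
qed

section \<open>The sampled error\<close>

lemma SSt_symmetric: "transpose (SSt T) = SSt T"
  by (simp add: SSt_def transpose_def vec_eq_iff mult.commute)

text \<open>The sum is the squared norm of the transposed sampling matrix applied to
  \<open>y\<close>, so \<open>SSt T\<close> is positive semidefinite.\<close>

lemma SSt_quadratic_form: "y \<bullet> (SSt T *v y) = (\<Sum>k<length T. (T ! k \<bullet> y)\<^sup>2)"
proof -
  have "(\<Sum>k<length T. (T ! k \<bullet> y)\<^sup>2)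
      = (\<Sum>k<length T. \<Sum>i\<in>UNIV. \<Sum>j\<in>UNIV. (T ! k $ i * y $ i) * (T ! k $ j * y $ j))"
    by (simp add: power2_eq_square inner_vec_def sum_product)
  also have "\<dots> = (\<Sum>i\<in>UNIV. \<Sum>k<length T. \<Sum>j\<in>UNIV. (T ! k $ i * y $ i) * (T ! k $ j * y $ j))"
    by (rule sum.swap)
  also have "\<dots> = (\<Sum>i\<in>UNIV. \<Sum>j\<in>UNIV. \<Sum>k<length T. (T ! k $ i * y $ i) * (T ! k $ j * y $ j))"
    by (intro sum.cong refl sum.swap)
  also have "\<dots> = y \<bullet> (SSt T *v y)"
    by (simp add: inner_vec_def matrix_vector_mult_def SSt_def sum_distrib_left sum_distrib_right mult_ac)
  finally show ?thesis by simp
qed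

text \<open>Expanding the square leaves the squared norm of \<open>?N *v e\<close>, which
  \<open>norm_symmetric_nonneg_le\<close> absorbs into the cross term.\<close>

lemma norm_error_step:
  fixes A :: "real^'n^'m"
  assumes "lambda_max (transpose A ** SSt T ** A) \<le> c" "0 < c"
  shows "(norm (e - \<alpha> *\<^sub>R ((transpose A ** SSt T) *v (A *v e))))\<^sup>2
    \<le> (norm e)\<^sup>2 - \<alpha> * (2 - \<alpha> * c) * ((A *v e) \<bullet> (SSt T *v (A *v e)))"
proof -
  let ?N = "transpose A ** SSt T ** A"
  have sym: "transpose ?N = ?N"
    by (simp add: matrix_transpose_mul SSt_symmetric matrix_mul_assoc)
  have form: "y \<bullet> (?N *v y) = (A *v y) \<bullet> (SSt T *v (A *v y))" for y
    by (simp add: inner_matrix_transpose flip: matrix_vector_mul_assoc)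
  have "y \<bullet> (?N *v y) \<le> c * (norm y)\<^sup>2" for y
    using quadratic_form_le_lambda_max[OF sym, of y] mult_right_mono[OF assms(1), of "(norm y)\<^sup>2"]
    by simp
  then have Ne: "(norm (?N *v e))\<^sup>2 \<le> c * (e \<bullet> (?N *v e))"
    using assms(2) sym form
    by (intro norm_symmetric_nonneg_le) (auto simp: SSt_quadratic_form intro: sum_nonneg)
  have "(norm (e - \<alpha> *\<^sub>R (?N *v e)))\<^sup>2
      = (norm e)\<^sup>2 - 2 * \<alpha> * (e \<bullet> (?N *v e)) + \<alpha>\<^sup>2 * (norm (?N *v e))\<^sup>2"
    unfolding power2_norm_eq_inner
    by (simp add: inner_diff_left inner_diff_right inner_commute power2_eq_square algebra_simps)
  also have "\<dots> \<le> (norm e)\<^sup>2 - 2 * \<alpha> * (e \<bullet> (?N *v e)) + \<alpha>\<^sup>2 * (c * (e \<bullet> (?N *v e)))"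
    by (intro add_left_mono mult_left_mono Ne) simp
  also have "\<dots> = (norm e)\<^sup>2 - \<alpha> * (2 - \<alpha> * c) * (e \<bullet> (?N *v e))"
    by (simp add: power2_eq_square algebra_simps)
  finally show ?thesis
    unfolding form by (simp flip: matrix_vector_mul_assoc)
qed

lemma brsi_error_Suc:
  fixes A :: "real^'n^'m"
  assumes "A *v xs = b"
  shows "brsi A b \<alpha> x0 T (Suc k) - xs = (brsi A b \<alpha> x0 T k - xs)
    - \<alpha> *\<^sub>R ((transpose A ** SSt (T k)) *v (A *v (brsi A b \<alpha> x0 T k - xs)))"
  by (simp add: assms matrix_vector_mult_diff_distrib[of A])

text \<open>Every update lies in the range of \<open>transpose A\<close>, so
  \<open>sigma_min_bound\<close> remains applicable to all errors.\<close>

lemma brsi_error_in_row_space: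
  fixes A :: "real^'n^'m"
  assumes "A *v xs = b" "x0 - xs \<in> range ((*v) (transpose A))"
  shows "brsi A b \<alpha> x0 T k - xs \<in> range ((*v) (transpose A))"
proof (induction k)
  case 0
  then show ?case using assms(2) by simp
next
  case (Suc k)
  show ?case
    unfolding brsi_error_Suc[OF assms(1)]
    by (intro subspace_diff subspace_scale subspace_range_matrix Suc.IH)
      (simp flip: matrix_vector_mul_assoc)
qed

text \<open>An iterate depends only on the draws before it, which is the source of its independence
  from draw \<open>k\<close>.\<close>

lemma brsi_cong: "(\<And>j. j < k \<Longrightarrow> T j = T' j) \<Longrightarrow> brsi A b \<alpha> x0 T k = brsi A b \<alpha> x0 T' k"
  by (induction k) auto

section \<open>Expectations\<close>

lemma borel_measurable_matrix_vector_mult [measurable (raw)]: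
  fixes W :: "'a \<Rightarrow> real^'n^'m" and y :: "'a \<Rightarrow> real^'n"
  assumes "W \<in> borel_measurable M" "y \<in> borel_measurable M"
  shows "(\<lambda>\<omega>. W \<omega> *v y \<omega>) \<in> borel_measurable M"
  using assms
  by (rule borel_measurable_continuous_Pair)
    (auto simp: matrix_vector_mult_def intro!: continuous_intros)

lemma borel_measurable_vec_nth [measurable (raw)]:
  fixes y :: "'a \<Rightarrow> 'b::real_normed_vector^'n"
  assumes "y \<in> borel_measurable M"
  shows "(\<lambda>\<omega>. y \<omega> $ i) \<in> borel_measurable M"
  by (rule measurable_compose[OF assms borel_measurable_continuous_onI])
    (intro continuous_intros)

text \<open>Only the draws below \<open>k\<close> are assumed measurable, so that \<open>T\<close>
  may range over the product space indexed by \<open>{..<k}\<close>.\<close>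

lemma brsi_measurable:
  fixes A :: "real^'n^'m"
  assumes [measurable]: "SSt \<in> borel_measurable (cols_space :: 'm cols measure)"
    and "\<And>j. j < k \<Longrightarrow> (\<lambda>\<omega>. T \<omega> j) \<in> measurable N cols_space"
  shows "(\<lambda>\<omega>. brsi A b \<alpha> x0 (T \<omega>) k) \<in> borel_measurable N"
  using assms(2)
proof (induction k)
  case (Suc k)
  then have [measurable]: "(\<lambda>\<omega>. brsi A b \<alpha> x0 (T \<omega>) k) \<in> borel_measurable N"
    "(\<lambda>\<omega>. T \<omega> k) \<in> measurable N cols_space"
    by auto
  show ?case
    unfolding brsi.simps matrix_vector_mul_assoc[symmetric] by measurable
qed simp

context prob_space
begin

text \<open>Expanded into entries, each expectation factors by independence, and the mean
  \<open>mat 1\<close> keeps only the diagonal terms. The bound on \<open>y\<close> supplies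
  integrability of the products of its coordinates.\<close>

lemma expectation_quadratic_form_indep:
  fixes y :: "'a \<Rightarrow> real^'m" and W :: "'a \<Rightarrow> real^'m^'m"
  assumes indep: "\<And>i j. indep_var borel (\<lambda>\<omega>. y \<omega> $ i * y \<omega> $ j) borel (\<lambda>\<omega>. W \<omega> $ i $ j)"
    and y[measurable]: "y \<in> borel_measurable M" and W: "has_bochner_integral M W (mat 1)"
    and bound: "AE \<omega> in M. norm (y \<omega>) \<le> B"
  shows "has_bochner_integral M (\<lambda>\<omega>. y \<omega> \<bullet> (W \<omega> *v y \<omega>)) (expectation (\<lambda>\<omega>. (norm (y \<omega>))\<^sup>2))"
proof -
  have yy: "integrable M (\<lambda>\<omega>. y \<omega> $ i * y \<omega> $ j)" for i j
  proof (rule integrable_const_bound)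
    show "AE \<omega> in M. norm (y \<omega> $ i * y \<omega> $ j) \<le> B * B"
      using bound
    proof eventually_elim
      case (elim \<omega>)
      then have "\<bar>y \<omega> $ i\<bar> \<le> B" "\<bar>y \<omega> $ j\<bar> \<le> B"
        using component_le_norm_cart order_trans by blast+
      then have "\<bar>y \<omega> $ i\<bar> * \<bar>y \<omega> $ j\<bar> \<le> B * B"
        by (intro mult_mono) auto
      then show ?case by (simp add: abs_mult)
    qed
  qed measurable
  have Wij: "has_bochner_integral M (\<lambda>\<omega>. W \<omega> $ i $ j) (mat 1 $ i $ j)" for i j
    by (intro has_bochner_integral_bounded_linear[OF bounded_linear_vec_nth] W)
  have "has_bochner_integral M (\<lambda>\<omega>. (y \<omega> $ i * y \<omega> $ j) * W \<omega> $ i $ j)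
      (expectation (\<lambda>\<omega>. y \<omega> $ i * y \<omega> $ j) * mat 1 $ i $ j)" for i j
    using indep_var_lebesgue_integral[OF indep[of i j] yy[of i j]] indep_var_integrable[OF indep[of i j] yy[of i j]]
      Wij[of i j]
    by (simp add: has_bochner_integral_iff)
  then have "has_bochner_integral M (\<lambda>\<omega>. \<Sum>i\<in>UNIV. \<Sum>j\<in>UNIV. (y \<omega> $ i * y \<omega> $ j) * W \<omega> $ i $ j)
      (\<Sum>i\<in>UNIV. \<Sum>j\<in>UNIV. expectation (\<lambda>\<omega>. y \<omega> $ i * y \<omega> $ j) * mat 1 $ i $ j)"
    by (intro has_bochner_integral_sum)
  moreover have "(\<Sum>i\<in>UNIV. \<Sum>j\<in>UNIV. (y \<omega> $ i * y \<omega> $ j) * W \<omega> $ i $ j) = y \<omega> \<bullet> (W \<omega> *v y \<omega>)" for \<omega>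
    by (simp add: inner_vec_def matrix_vector_mult_def sum_distrib_left mult_ac)
  moreover have "(\<Sum>i\<in>UNIV. \<Sum>j\<in>UNIV. expectation (\<lambda>\<omega>. y \<omega> $ i * y \<omega> $ j) * mat 1 $ i $ j)
      = expectation (\<lambda>\<omega>. (norm (y \<omega>))\<^sup>2)"
  proof -
    have "(\<Sum>j\<in>UNIV. expectation (\<lambda>\<omega>. y \<omega> $ i * y \<omega> $ j) * mat 1 $ i $ j)
        = expectation (\<lambda>\<omega>. y \<omega> $ i * y \<omega> $ i)" for i
      by (simp add: mat_def if_distrib cong: if_cong)
    then show ?thesis
      using yy by (simp add: power2_norm_eq_inner inner_vec_def)
  qed
  ultimately show ?thesis by simp
qed

text \<open>The iterate and the fresh draw are measurable functions of the disjoint coordinate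
  blocks \<open>{..<k}\<close> and \<open>{k}\<close>.\<close>

lemma brsi_indep:
  fixes h :: "real^'n \<Rightarrow> real" and S :: "nat \<Rightarrow> 'a \<Rightarrow> 'm::finite cols"
  assumes indep: "indep_vars (\<lambda>_. cols_space) S UNIV"
    and SSt: "SSt \<in> borel_measurable (cols_space :: 'm cols measure)"
    and h: "h \<in> borel_measurable borel" and g: "g \<in> borel_measurable borel"
  shows "indep_var borel (\<lambda>\<omega>. h (brsi A b \<alpha> x0 (\<lambda>j. S j \<omega>) k)) borel (\<lambda>\<omega>. g (SSt (S k \<omega>)))"
proof -
  have "indep_var (PiM {..<k} (\<lambda>_. cols_space)) (\<lambda>\<omega>. restrict (\<lambda>i. S i \<omega>) {..<k})
      (PiM {k} (\<lambda>_. cols_space)) (\<lambda>\<omega>. restrict (\<lambda>i. S i \<omega>) {k})"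
    by (rule indep_var_restrict[OF indep]) auto
  moreover have "(\<lambda>T. h (brsi A b \<alpha> x0 T k)) \<in> borel_measurable (PiM {..<k} (\<lambda>_. cols_space))"
    by (rule measurable_compose[OF brsi_measurable[OF SSt] h])
      (auto intro: measurable_component_singleton)
  moreover have "(\<lambda>T. g (SSt (T k))) \<in> borel_measurable (PiM {k} (\<lambda>_. cols_space))"
    by (intro measurable_compose[OF _ g] measurable_compose[OF _ SSt] measurable_component_singleton) simp
  ultimately have "indep_var borel ((\<lambda>T. h (brsi A b \<alpha> x0 T k)) \<circ> (\<lambda>\<omega>. restrict (\<lambda>i. S i \<omega>) {..<k}))
      borel ((\<lambda>T. g (SSt (T k))) \<circ> (\<lambda>\<omega>. restrict (\<lambda>i. S i \<omega>) {k}))"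
    by (rule indep_var_compose)
  \<comment> \<open>Outside \<open>{..<k}\<close> the restriction is \<open>undefined\<close>, but
    the iterate does not read those coordinates.\<close>
  moreover have "brsi A b \<alpha> x0 (restrict (\<lambda>i. S i \<omega>) {..<k}) k = brsi A b \<alpha> x0 (\<lambda>j. S j \<omega>) k" for \<omega>
    by (rule brsi_cong) simp
  ultimately show ?thesis
    by (simp add: comp_def)
qed

end

text \<open>Multiplying the induction hypothesis by \<open>r\<close> needs \<open>0 \<le> r\<close>.
  The sign of \<open>eta_r\<close> is not established, so both cases are treated.\<close>

lemma nonneg_geometric_bound:
  fixes a :: "nat \<Rightarrow> real"
  assumes nonneg: "\<And>k. 0 \<le> a k" and step: "\<And>k. a (Suc k) \<le> r * a k"
  shows "a k \<le> r ^ k * a 0"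
proof (cases "0 \<le> r")
  case True
  show ?thesis
  proof (induction k)
    case (Suc k)
    have "a (Suc k) \<le> r * (r ^ k * a 0)"
      using step[of k] mult_left_mono[OF Suc.IH True] by simp
    then show ?case by simp
  qed simp
next
  case False
  \<comment> \<open>A negative ratio forces the sequence to vanish.\<close>
  have "a k = 0" for k
  proof -
    have "0 \<le> r * a k"
      using nonneg[of "Suc k"] step[of k] by linarith
    with False nonneg[of k] show ?thesis
      by (simp add: zero_le_mult_iff)
  qed
  then show ?thesis by simp
qed

section \<open>Linear convergence in mean square\<close>

theorem theorem5:
  fixes A :: "real^'n^'m" and b :: "real^'m" and x0 :: "real^'n" and \<alpha> :: real
    and D :: "'m cols measure" and R :: "'m cols set"
    and M :: "'w measure" and S :: "nat \<Rightarrow> 'w \<Rightarrow> 'm cols" and k :: nat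
  assumes distribution: "sampling_distribution D R"
    and max_exists: "\<exists>T\<in>R. \<forall>T'\<in>R. lambda_max (transpose A ** SSt T' ** A)
                                   \<le> lambda_max (transpose A ** SSt T ** A)"
    and prob: "prob_space M"
    and indep: "prob_space.indep_vars M (\<lambda>_. cols_space) S UNIV"
    and law: "\<And>j. distr M cols_space (S j) = D"
    and A_nonzero: "A \<noteq> 0"
    and stepsize: "0 < \<alpha>" "\<alpha> < 2 / lambda_max_r A R"
    and consistent: "\<exists>x. A *v x = b"
  shows "integrable M (\<lambda>\<omega>. (norm (brsi A b \<alpha> x0 (\<lambda>j. S j \<omega>) k - x_star0 A b x0))\<^sup>2) \<and>
         prob_space.expectation M
           (\<lambda>\<omega>. (norm (brsi A b \<alpha> x0 (\<lambda>j. S j \<omega>) k - x_star0 A b x0))\<^sup>2)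
         \<le> eta_r A R \<alpha> ^ k * (norm (x0 - x_star0 A b x0))\<^sup>2"
proof -
  interpret prob_space M by (rule prob)
  define c where "c = lambda_max_r A R"
  define xs where "xs = x_star0 A b x0"
  define e where "e k \<omega> = brsi A b \<alpha> x0 (\<lambda>j. S j \<omega>) k - xs" for k \<omega>
  define \<gamma> where "\<gamma> = \<alpha> * (2 - \<alpha> * c)"
  \<comment> \<open>A stepsize exists, so the quotient is positive; this excludes
    \<open>c = 0\<close> too, as division by zero yields zero.\<close>
  have "0 < 2 / c"
    using stepsize unfolding c_def by (rule less_trans)
  then have c: "0 < c"
    by (simp add: zero_less_divide_iff)
  have \<gamma>: "0 \<le> \<gamma>"
    using stepsize c by (simp add: \<gamma>_def c_def field_simps)
  have R: "lambda_max (transpose A ** SSt T ** A) \<le> c" if "T \<in> R" for T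
  proof -
    obtain T0 where T0: "T0 \<in> R"
      "\<And>T. T \<in> R \<Longrightarrow> lambda_max (transpose A ** SSt T ** A) \<le> lambda_max (transpose A ** SSt T0 ** A)"
      using max_exists by blast
    \<comment> \<open>Attainment of the maximum is what allows \<open>GREATEST\<close> to be
      evaluated.\<close>
    have "c = lambda_max (transpose A ** SSt T0 ** A)"
      unfolding c_def lambda_max_r_def using T0 by (intro Greatest_equality) auto
    with T0(2)[OF that] show ?thesis by simp
  qed
  have D: "sets D = sets cols_space" "AE T in D. T \<in> R" "has_bochner_integral D SSt (mat 1)"
    using distribution unfolding sampling_distribution_def by auto
  \<comment> \<open>Measurability is read off from integrability under \<open>D\<close>, whose
    sigma-algebra is that of \<open>cols_space\<close>.\<close>
  have SSt[measurable]: "SSt \<in> borel_measurable (cols_space :: 'm cols measure)"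
    using borel_measurable_has_bochner_integral[OF D(3)] measurable_cong_sets[OF D(1) refl] by auto
  have S[measurable]: "S j \<in> measurable M cols_space" for j
    using indep unfolding indep_vars_def by simp
  have W: "has_bochner_integral M (\<lambda>\<omega>. SSt (S j \<omega>)) (mat 1)" for j
    using D(3) integrable_distr_eq[OF S SSt, of j] integral_distr[OF S SSt, of j]
    by (simp add: law has_bochner_integral_iff)
  have SR: "AE \<omega> in M. S j \<omega> \<in> R" for j
    by (rule AE_distrD[OF S]) (unfold law, rule D(2))
  have xs: "A *v xs = b" "x0 - xs \<in> range ((*v) (transpose A))"
    unfolding xs_def using x_star0_solves[OF consistent] by auto
  have [measurable]: "e k \<in> borel_measurable M" for k
    unfolding e_def[abs_def]
    by (intro borel_measurable_diff borel_measurable_const brsi_measurable SSt S)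
  have indep_e: "indep_var borel (\<lambda>\<omega>. (A *v e k \<omega>) $ i * (A *v e k \<omega>) $ j)
      borel (\<lambda>\<omega>. SSt (S k \<omega>) $ i $ j)" for k i j
    unfolding e_def
    by (rule brsi_indep[OF indep SSt, where g = "\<lambda>N. N $ i $ j"
          and h = "\<lambda>x. (A *v (x - xs)) $ i * (A *v (x - xs)) $ j"]) measurable
  define q where "q k \<omega> = (A *v e k \<omega>) \<bullet> (SSt (S k \<omega>) *v (A *v e k \<omega>))" for k \<omega>
  have q: "0 \<le> q k \<omega>" for k \<omega>
    by (simp add: q_def SSt_quadratic_form sum_nonneg)
  have step: "AE \<omega> in M. (norm (e (Suc k) \<omega>))\<^sup>2 \<le> (norm (e k \<omega>))\<^sup>2 - \<gamma> * q k \<omega>" for k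
    using SR[of k]
  proof eventually_elim
    case (elim \<omega>)
    show ?case
      using norm_error_step[OF R[OF elim] c, of "e k \<omega>" \<alpha>]
      unfolding e_def brsi_error_Suc[OF xs(1)] by (simp add: q_def e_def \<gamma>_def)
  qed
  \<comment> \<open>The bound is almost sure because each draw lies in \<open>R\<close> only almost
    surely.\<close>
  have bound: "AE \<omega> in M. norm (e k \<omega>) \<le> norm (x0 - xs)" for k
  proof (induction k)
    case (Suc k)
    from Suc.IH step[of k] show ?case
    proof eventually_elim
      case (elim \<omega>)
      have "(norm (e (Suc k) \<omega>))\<^sup>2 \<le> (norm (e k \<omega>))\<^sup>2"
        using elim(2) mult_nonneg_nonneg[OF \<gamma> q[of k \<omega>]] by linarith
      then have "norm (e (Suc k) \<omega>) \<le> norm (e k \<omega>)"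
        by (rule power2_le_imp_le) simp
      with elim(1) show ?case by simp
    qed
  qed (simp add: e_def)
  have int: "integrable M (\<lambda>\<omega>. (norm (e k \<omega>))\<^sup>2)" for k
  proof (rule integrable_const_bound)
    show "AE \<omega> in M. norm ((norm (e k \<omega>))\<^sup>2) \<le> (norm (x0 - xs))\<^sup>2"
      using bound[of k] by eventually_elim (simp add: power_mono)
  qed measurable
  have Abound: "AE \<omega> in M. norm (A *v e k \<omega>) \<le> onorm ((*v) A) * norm (x0 - xs)" for k
    using bound[of k]
  proof eventually_elim
    case (elim \<omega>)
    have "norm (A *v e k \<omega>) \<le> onorm ((*v) A) * norm (e k \<omega>)"
      by (intro onorm matrix_vector_mul_bounded_linear)
    also have "\<dots> \<le> onorm ((*v) A) * norm (x0 - xs)"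
      by (intro mult_left_mono elim onorm_pos_le matrix_vector_mul_bounded_linear)
    finally show ?case .
  qed
  have intA: "integrable M (\<lambda>\<omega>. (norm (A *v e k \<omega>))\<^sup>2)" for k
  proof (rule integrable_const_bound)
    show "AE \<omega> in M. norm ((norm (A *v e k \<omega>))\<^sup>2) \<le> (onorm ((*v) A) * norm (x0 - xs))\<^sup>2"
      using Abound[of k] by eventually_elim (simp add: power_mono)
  qed measurable
  have qint: "has_bochner_integral M (q k) (expectation (\<lambda>\<omega>. (norm (A *v e k \<omega>))\<^sup>2))" for k
    unfolding q_def[abs_def] by (rule expectation_quadratic_form_indep[OF indep_e _ W Abound]) measurable
  have "expectation (\<lambda>\<omega>. (norm (e (Suc k) \<omega>))\<^sup>2)
      \<le> eta_r A R \<alpha> * expectation (\<lambda>\<omega>. (norm (e k \<omega>))\<^sup>2)" for k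
  proof -
    have "expectation (\<lambda>\<omega>. (norm (e (Suc k) \<omega>))\<^sup>2) \<le> expectation (\<lambda>\<omega>. (norm (e k \<omega>))\<^sup>2 - \<gamma> * q k \<omega>)"
      using qint[of k] int by (intro integral_mono_AE step) (auto simp: has_bochner_integral_iff)
    also have "\<dots> = expectation (\<lambda>\<omega>. (norm (e k \<omega>))\<^sup>2) - \<gamma> * expectation (\<lambda>\<omega>. (norm (A *v e k \<omega>))\<^sup>2)"
      using qint[of k] int[of k] by (simp add: has_bochner_integral_iff)
    \<comment> \<open>Membership in the row space holds for every outcome, so the singular value
      bound integrates pointwise.\<close>
    also have "\<dots> \<le> expectation (\<lambda>\<omega>. (norm (e k \<omega>))\<^sup>2)
        - \<gamma> * expectation (\<lambda>\<omega>. (sigma_min A)\<^sup>2 * (norm (e k \<omega>))\<^sup>2)"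
      using int[of k] intA[of k] brsi_error_in_row_space[OF xs]
      by (intro diff_left_mono mult_left_mono \<gamma> integral_mono sigma_min_bound A_nonzero)
        (auto simp: e_def)
    also have "\<dots> = eta_r A R \<alpha> * expectation (\<lambda>\<omega>. (norm (e k \<omega>))\<^sup>2)"
      by (simp add: eta_r_def \<gamma>_def c_def algebra_simps)
    finally show ?thesis .
  qed
  then have "expectation (\<lambda>\<omega>. (norm (e k \<omega>))\<^sup>2)
      \<le> eta_r A R \<alpha> ^ k * expectation (\<lambda>\<omega>. (norm (e 0 \<omega>))\<^sup>2)"
    by (intro nonneg_geometric_bound) auto
  also have "expectation (\<lambda>\<omega>. (norm (e 0 \<omega>))\<^sup>2) = (norm (x0 - xs))\<^sup>2"
    by (simp add: e_def prob_space)
  finally show ?thesis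
    using int[of k] unfolding e_def xs_def by blast
qed

end
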